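(* Let $\Sigma_S$ be the input-output stochastic differential system $dx=f(x,u)\,dt+h(x,u)\,d\omega$, $y=s(x,u)$. If there exists a radially unbounded Lyapunov function with respect to which $\Sigma_S$ is stochastically passive, then the unforced diffusion term vanishes at the stochastic passive state $\bar x$, i.e. $h(\bar x,0_m)=0_{n\times r}$.
   Context: In $\Sigma_S$, $x\in\mathbb{R}^n$ is the state, $u\in\mathbb{U}\subseteq\mathbb{R}^m$ the input with $0_m\in\mathbb{U}$, $y\in\mathbb{R}^m$ the output, $\omega$ a standard $r$-dimensional Wiener process, and $f:\mathbb{R}^n\times\mathbb{U}\to\mathbb{R}^n$, $h:\mathbb{R}^n\times\mathbb{U}\to\mathbb{R}^{n\times r}$, $s:\mathbb{R}^n\times\mathbb{U}\to\mathbb{R}^m$ are locally Lipschitz continuous. The infinitesimal generator is $\mathcal{L}[V]=\frac{\partial V}{\partial x}f+\frac12\mathrm{tr}\{\frac{\partial^2 V}{\partial x^2}hh^\top\}$. $\Sigma_S$ is stochastically passive with respect to a nonnegative $C^2$ function $S:\mathbb{R}^n\to\mathbb{R}$ (the storage function) if $\mathcal{L}[S(x)]\le u^\top y$ for all $x\in\mathbb{R}^n$ and $u\in\mathbb{U}$, where $y=s(x,u)$. The state where $S=0$ is called the stochastic passive state. "Radially unbounded Lyapunov function" means a $C^2$ function $V:\mathbb{R}^n\to\mathbb{R}$ that is positive definite with respect to $x-\bar x$ for some state $\bar x$ (i.e. $V(\bar x)=0$ and $V(x)>0$ for $x\neq\bar x$) and satisfies $V(x)\to\infty$ as $\|x\|_2\to\infty$;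 it is used as the storage function, so that $\bar x$ is the stochastic passive state. *)

theory Defs
  imports "HOL-Analysis.Analysis"
begin

definition gradient :: "(real^'n \<Rightarrow> real) \<Rightarrow> real^'n \<Rightarrow> real^'n"
  where "gradient V x = (\<chi> i. frechet_derivative V (at x) (axis i 1))"

definition hessian :: "(real^'n \<Rightarrow> real) \<Rightarrow> real^'n \<Rightarrow> real^'n^'n"
  where "hessian V x = jacobian (gradient V) (at x)"

text \<open>Continuity of \<open>V\<close> and of its gradient is implied by differentiability.\<close>

definition C2 :: "(real^'n \<Rightarrow> real) \<Rightarrow> bool"
  where "C2 V \<longleftrightarrow> V differentiable_on UNIV \<and> gradient V differentiable_on UNIV \<and>
    continuous_on UNIV (hessian V)"

text \<open>The library's \<open>local_lipschitz\<close> is Lipschitz only in its second argument, uniformly in the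
  first; here the condition is joint in all variables. Neighbourhoods are relative to \<open>X\<close>.\<close>

definition locally_lipschitz_on ::
    "'a::metric_space set \<Rightarrow> ('a \<Rightarrow> 'b::metric_space) \<Rightarrow> bool"
  where "locally_lipschitz_on X g \<longleftrightarrow>
    (\<forall>p\<in>X. \<exists>e>0. \<exists>L. L-lipschitz_on (cball p e \<inter> X) g)"

text \<open>The system \<open>dx = f(x,u) dt + h(x,u) d\<omega>\<close>, \<open>y = s(x,u)\<close> with input set \<open>U\<close> is represented by
  its coefficients; the dimension of the Wiener process \<open>\<omega>\<close> is the number of columns of \<open>h\<close>.
  Only the values of \<open>f\<close>, \<open>h\<close>, \<open>s\<close> at inputs in \<open>U\<close> matter.\<close>

definition io_stochastic_system ::
    "(real^'m) set \<Rightarrow> (real^'n \<Rightarrow> real^'m \<Rightarrow> real^'n) \<Rightarrow> (real^'n \<Rightarrow> real^'m \<Rightarrow> real^'r^'n) \<Rightarrow>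
     (real^'n \<Rightarrow> real^'m \<Rightarrow> real^'m) \<Rightarrow> bool"
  where "io_stochastic_system U f h s \<longleftrightarrow> 0 \<in> U \<and>
    locally_lipschitz_on (UNIV \<times> U) (\<lambda>(x, u). f x u) \<and>
    locally_lipschitz_on (UNIV \<times> U) (\<lambda>(x, u). h x u) \<and>
    locally_lipschitz_on (UNIV \<times> U) (\<lambda>(x, u). s x u)"

definition generator ::
    "(real^'n \<Rightarrow> real^'m \<Rightarrow> real^'n) \<Rightarrow> (real^'n \<Rightarrow> real^'m \<Rightarrow> real^'r^'n) \<Rightarrow>
     (real^'n \<Rightarrow> real) \<Rightarrow> real^'n \<Rightarrow> real^'m \<Rightarrow> real"
  where "generator f h V x u = gradient V x \<bullet> f x u +
    1/2 * trace (hessian V x ** h x u ** transpose (h x u))"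

definition stochastically_passive ::
    "(real^'m) set \<Rightarrow> (real^'n \<Rightarrow> real^'m \<Rightarrow> real^'n) \<Rightarrow> (real^'n \<Rightarrow> real^'m \<Rightarrow> real^'r^'n) \<Rightarrow>
     (real^'n \<Rightarrow> real^'m \<Rightarrow> real^'m) \<Rightarrow> (real^'n \<Rightarrow> real) \<Rightarrow> bool"
  where "stochastically_passive U f h s S \<longleftrightarrow> C2 S \<and> (\<forall>x. 0 \<le> S x) \<and>
    (\<forall>x. \<forall>u\<in>U. generator f h S x u \<le> u \<bullet> s x u)"

definition stochastic_passive_state :: "(real^'n \<Rightarrow> real) \<Rightarrow> real^'n \<Rightarrow> bool"
  where "stochastic_passive_state S x \<longleftrightarrow> S x = 0"

definition positive_definite_about :: "real^'n \<Rightarrow> (real^'n \<Rightarrow> real) \<Rightarrow> bool"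
  where "positive_definite_about xbar V \<longleftrightarrow> V xbar = 0 \<and> (\<forall>x. x \<noteq> xbar \<longrightarrow> 0 < V x)"

definition radially_unbounded_lyapunov :: "(real^'n \<Rightarrow> real) \<Rightarrow> bool"
  where "radially_unbounded_lyapunov V \<longleftrightarrow>
    C2 V \<and> (\<exists>xbar. positive_definite_about xbar V) \<and> filterlim V at_top at_infinity"

end

theory Submission imports Defs begin

text \<open>
  The passive state \<open>xbar\<close> is the strict global minimum of \<open>V\<close>, and passivity with zero input says
  that \<open>V\<close> is a supersolution, \<open>L[V] \<le> 0\<close>, of the possibly degenerate elliptic operator \<open>L\<close> of the
  unforced system. Probabilistically, \<open>V\<close> along a solution started at \<open>xbar\<close> is a nonnegative
  supermartingale with initial value \<open>0\<close>, so the solution never leaves \<open>xbar\<close> and cannot be driven by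
  noise there. The proof below replaces this by a maximum principle argument, in which no solution
  of the stochastic differential equation appears.

  Suppose row \<open>i\<close> of \<open>h xbar 0\<close> is nonzero, and take the barrier \<open>w x = (x$i - xbar$i)\<^sup>2\<close>. At \<open>xbar\<close>
  the first-order part of \<open>L[w]\<close> vanishes and the second-order part is the squared norm of that row,
  so by continuity of the coefficients \<open>L[w] > 0\<close> on a whole closed ball \<open>B\<close> about \<open>xbar\<close>.
  On the boundary sphere \<open>V\<close> is bounded below by a positive constant, so for small \<open>\<epsilon> > 0\<close> the
  function \<open>V - \<epsilon> w\<close> is positive there, while it is \<open>0\<close> at \<open>xbar\<close>. Hence its minimum over \<open>B\<close> is
  attained at an interior point \<open>p\<close>. At an interior minimum the gradient vanishes and the Hessian is
  positive semidefinite, so \<open>L[V] \<ge> \<epsilon> L[w] > 0\<close> at \<open>p\<close>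
  (lemma \<open>generator_ge_at_touching_point\<close>), contradicting \<open>L[V] \<le> 0\<close>.

  The detour through nearby points \<open>p\<close> is needed because the Hessian of \<open>V\<close> at \<open>xbar\<close> may be
  singular: evaluating \<open>L[V] \<le> 0\<close> at \<open>xbar\<close> itself settles the case of a positive definite Hessian,
  but says nothing for, say, \<open>V x = norm x ^ 4\<close> about the origin.
\<close>

section \<open>Gradient and Hessian along lines\<close>

lemma has_derivative_gradient:
  fixes V :: "real^'n \<Rightarrow> real"
  assumes "V differentiable (at x)"
  shows "(V has_derivative (\<lambda>v. gradient V x \<bullet> v)) (at x)"
proof -
  let ?D = "frechet_derivative V (at x)"
  have D: "(V has_derivative ?D) (at x)"
    using assms frechet_derivative_works by blast
  interpret bounded_linear ?D
    using D by (rule has_derivative_bounded_linear)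
  have "?D v = gradient V x \<bullet> v" for v
  proof -
    have "?D v = ?D (\<Sum>i\<in>UNIV. v$i *\<^sub>R axis i 1)"
      using basis_expansion[of v] by (simp add: scalar_mult_eq_scaleR)
    also have "\<dots> = gradient V x \<bullet> v"
      by (simp add: sum scale gradient_def inner_vec_def mult.commute)
    finally show ?thesis .
  qed
  then have "?D = (\<lambda>v. gradient V x \<bullet> v)"
    by blast
  with D show ?thesis
    by simp
qed

lemma has_field_derivative_along_line:
  fixes V :: "real^'n \<Rightarrow> real"
  assumes "V differentiable (at (p + t *\<^sub>R v))"
  shows "((\<lambda>t. V (p + t *\<^sub>R v)) has_field_derivative (gradient V (p + t *\<^sub>R v) \<bullet> v)) (at t)"
proof -
  have "((\<lambda>t. p + t *\<^sub>R v) has_derivative (\<lambda>t. t *\<^sub>R v)) (at t)"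
    by (auto intro!: derivative_eq_intros)
  from has_derivative_compose[OF this has_derivative_gradient[OF assms]]
  show ?thesis
    by (simp add: has_field_derivative_def mult.commute mult_commute_abs)
qed

lemma has_field_derivative_gradient_along_line:
  fixes V :: "real^'n \<Rightarrow> real"
  assumes "gradient V differentiable (at p)"
  shows "((\<lambda>t. gradient V (p + t *\<^sub>R v) \<bullet> v) has_field_derivative (v \<bullet> (hessian V p *v v))) (at 0)"
proof -
  have H: "(gradient V has_derivative (\<lambda>v. hessian V p *v v)) (at p)"
    using assms by (simp add: hessian_def jacobian_works)
  have "((\<lambda>t. p + t *\<^sub>R v) has_derivative (\<lambda>t. t *\<^sub>R v)) (at 0)"
    by (auto intro!: derivative_eq_intros)
  then have "((\<lambda>t. gradient V (p + t *\<^sub>R v)) has_derivative (\<lambda>t. hessian V p *v (t *\<^sub>R v))) (at 0)"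
    by (rule has_derivative_compose) (simp add: H)
  then have "((\<lambda>t. gradient V (p + t *\<^sub>R v) \<bullet> v) has_derivative
      (\<lambda>t. (hessian V p *v (t *\<^sub>R v)) \<bullet> v)) (at 0)"
    by (rule has_derivative_inner_left)
  then show ?thesis
    by (simp add: has_field_derivative_def matrix_vector_mult_scaleR inner_commute
        mult_commute_abs)
qed

text \<open>The derivative \<open>g'\<close> vanishes at the minimum; a negative slope there would make \<open>g'\<close> negative,
  hence \<open>g\<close> decreasing, just to the right.\<close>

lemma second_derivative_nonneg_at_local_min:
  fixes g :: "real \<Rightarrow> real"
  assumes g: "\<And>t. (g has_field_derivative g' t) (at t)"
    and g': "(g' has_field_derivative c) (at x)"
    and "0 < d" and min: "\<And>t. \<bar>x - t\<bar> < d \<Longrightarrow> g x \<le> g t"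
  shows "g' x = 0" and "0 \<le> c"
proof -
  show zero: "g' x = 0"
    using DERIV_local_min[OF g \<open>0 < d\<close>] min by blast
  show "0 \<le> c"
  proof (rule ccontr)
    assume "\<not> 0 \<le> c"
    then obtain e where "0 < e" and neg: "\<And>k. 0 < k \<Longrightarrow> k < e \<Longrightarrow> g' (x + k) < 0"
      using DERIV_neg_dec_right[OF g'] zero by force
    define k where "k = min d e / 2"
    have k: "0 < k" "k < d" "k < e"
      using \<open>0 < d\<close> \<open>0 < e\<close> by (auto simp: k_def)
    obtain z where z: "x < z" "z < x + k" "g (x + k) - g x = k * g' z"
      using MVT2[of x "x + k" g g'] g k by auto
    have "g' z < 0"
      using neg[of "z - x"] z k by simp
    then have "g (x + k) < g x"
      using z k mult_pos_neg[of k "g' z"] by simp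
    then show False
      using min[of "x + k"] k by simp
  qed
qed

section \<open>Comparison of generators at a touching point\<close>

text \<open>This is how the generator tests the Hessian: once in the direction of each column of the
  diffusion matrix.\<close>

lemma trace_mult_transpose_eq_sum_columns:
  fixes A :: "real^'n^'n" and B :: "real^'r^'n"
  shows "trace (A ** B ** transpose B) = (\<Sum>j\<in>UNIV. column j B \<bullet> (A *v column j B))"
proof -
  have "trace (A ** B ** transpose B) = (\<Sum>i\<in>UNIV. \<Sum>j\<in>UNIV. (A ** B)$i$j * B$i$j)"
    by (simp add: trace_def matrix_matrix_mult_def transpose_def)
  also have "\<dots> = (\<Sum>j\<in>UNIV. \<Sum>i\<in>UNIV. (A ** B)$i$j * B$i$j)"
    by (rule sum.swap)
  finally show ?thesis
    by (simp add: matrix_matrix_mult_def matrix_vector_mult_def column_def inner_vec_def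
        mult.commute)
qed

text \<open>Where \<open>V\<close> minus the barrier \<open>\<epsilon> * (x$i - c)\<^sup>2\<close> has a local minimum, restricting to the line in
  direction \<open>v\<close> compares first and second derivatives of the two functions: equality of gradients
  handles the drift, and the second-order comparison along the columns of \<open>h p u\<close> handles the
  diffusion. The lower bound is the generator applied to the barrier, with its derivatives
  written out.\<close>

lemma generator_ge_at_touching_point:
  fixes V :: "real^'n \<Rightarrow> real" and h :: "real^'n \<Rightarrow> real^'m \<Rightarrow> real^'r^'n"
  assumes V: "\<And>x. V differentiable (at x)" and G: "gradient V differentiable (at p)"
    and "0 < d"
    and min: "\<And>x. dist p x < d \<Longrightarrow> V p - \<epsilon> * (p$i - c)\<^sup>2 \<le> V x - \<epsilon> * (x$i - c)\<^sup>2"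
  shows "generator f h V p u \<ge>
    \<epsilon> * (2 * (p$i - c) * (f p u $ i) + (\<Sum>j\<in>UNIV. (h p u $ i $ j)\<^sup>2))"
proof -
  have "gradient V p \<bullet> v - 2 * \<epsilon> * (p$i - c) * v$i = 0"
    and "0 \<le> v \<bullet> (hessian V p *v v) - 2 * \<epsilon> * (v$i)\<^sup>2" for v
  proof -
    define g where "g t = V (p + t *\<^sub>R v) - \<epsilon> * (p$i + t * v$i - c)\<^sup>2" for t
    define g' where "g' t = gradient V (p + t *\<^sub>R v) \<bullet> v - 2 * \<epsilon> * (p$i + t * v$i - c) * v$i" for t
    have 1: "(g has_field_derivative g' t) (at t)" for t
      unfolding g_def g'_def
      by (rule derivative_eq_intros has_field_derivative_along_line V refl | simp)+
    have 2: "(g' has_field_derivative v \<bullet> (hessian V p *v v) - 2 * \<epsilon> * (v$i)\<^sup>2) (at 0)"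
      unfolding g'_def
      by (rule derivative_eq_intros has_field_derivative_gradient_along_line G refl
          | simp add: power2_eq_square)+
    have 3: "0 < d / (norm v + 1)"
      using \<open>0 < d\<close> by (simp add: add_nonneg_pos)
    have 4: "g 0 \<le> g t" if "\<bar>0 - t\<bar> < d / (norm v + 1)" for t
    proof -
      have "\<bar>t\<bar> * norm v \<le> \<bar>t\<bar> * (norm v + 1)"
        by (simp add: mult_left_mono)
      also have "\<dots> < d"
        using that by (simp add: pos_less_divide_eq add_nonneg_pos)
      finally have "dist p (p + t *\<^sub>R v) < d"
        by (simp add: dist_norm)
      from min[OF this] show ?thesis
        by (simp add: g_def)
    qed
    show "gradient V p \<bullet> v - 2 * \<epsilon> * (p$i - c) * v$i = 0"
      using second_derivative_nonneg_at_local_min(1)[OF 1 2 3 4] by (simp add: g'_def)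
    show "0 \<le> v \<bullet> (hessian V p *v v) - 2 * \<epsilon> * (v$i)\<^sup>2"
      using second_derivative_nonneg_at_local_min(2)[OF 1 2 3 4] .
  qed
  note first = this(1) and second = this(2)
  have "(\<Sum>j\<in>UNIV. 2 * \<epsilon> * (h p u $ i $ j)\<^sup>2)
      \<le> trace (hessian V p ** h p u ** transpose (h p u))"
    unfolding trace_mult_transpose_eq_sum_columns
  proof (rule sum_mono)
    fix j
    show "2 * \<epsilon> * (h p u $ i $ j)\<^sup>2 \<le> column j (h p u) \<bullet> (hessian V p *v column j (h p u))"
      using second[of "column j (h p u)"] by (simp add: column_def)
  qed
  then show ?thesis
    using first[of "f p u"]
    by (simp add: generator_def sum_distrib_left[symmetric] algebra_simps)
qed

section \<open>Vanishing of the unforced diffusion\<close>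

lemma locally_lipschitz_on_imp_continuous_on:
  assumes "locally_lipschitz_on X g"
  shows "continuous_on X g"
  unfolding continuous_on_eq_continuous_within
proof
  fix p assume "p \<in> X"
  then obtain e L where "0 < e" and L: "L-lipschitz_on (cball p e \<inter> X) g"
    using assms by (auto simp: locally_lipschitz_on_def)
  have "continuous_on (X \<inter> ball p e) g"
    by (rule continuous_on_subset[OF lipschitz_on_continuous_on[OF L]]) auto
  then have "continuous (at p within X \<inter> ball p e) g"
    using \<open>p \<in> X\<close> \<open>0 < e\<close> by (simp add: continuous_on_eq_continuous_within)
  moreover have "at p within X \<inter> ball p e = at p within X"
    using \<open>0 < e\<close> by (intro at_within_nhd[of p "ball p e"]) auto
  ultimately show "continuous (at p within X) g"
    by simp
qed

lemma locally_lipschitz_on_imp_continuous_on_slice: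
  assumes "locally_lipschitz_on (UNIV \<times> U) (\<lambda>(x, u). g x u)" and "u \<in> U"
  shows "continuous_on UNIV (\<lambda>x. g x u)"
proof -
  have "continuous_on UNIV (\<lambda>x. (\<lambda>(x, u). g x u) (x, u))"
    by (rule continuous_on_compose2[OF locally_lipschitz_on_imp_continuous_on[OF assms(1)]])
      (auto intro: continuous_intros assms(2))
  then show ?thesis
    by simp
qed

text \<open>Strictness of the minimum is what makes
  \<open>V\<close> minus a small multiple of the barrier positive on the \<^emph>\<open>whole\<close> sphere about \<open>q\<close>, also in the
  directions in which the operator degenerates.\<close>

lemma diffusion_vanishes_at_strict_minimum:
  fixes V :: "real^'n \<Rightarrow> real" and h :: "real^'n \<Rightarrow> real^'m \<Rightarrow> real^'r^'n"
  assumes V: "\<And>x. V differentiable (at x)" and G: "\<And>x. gradient V differentiable (at x)"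
    and pos: "positive_definite_about q V"
    and f: "continuous_on UNIV (\<lambda>x. f x u)" and h: "continuous_on UNIV (\<lambda>x. h x u)"
    and super: "\<And>x. generator f h V x u \<le> 0"
  shows "h q u = 0"
proof (rule ccontr)
  assume "h q u \<noteq> 0"
  then obtain i k where ik: "h q u $ i $ k \<noteq> 0"
    by (auto simp: vec_eq_iff)
  \<comment> \<open>the generator applied to the barrier \<open>(x$i - q$i)\<^sup>2\<close>\<close>
  define Lw where "Lw x = 2 * (x$i - q$i) * (f x u $ i) + (\<Sum>j\<in>UNIV. (h x u $ i $ j)\<^sup>2)" for x
  have "0 < Lw q"
    unfolding Lw_def using ik by (auto intro!: sum_pos2[of UNIV k])
  moreover have "continuous_on UNIV Lw"
    unfolding Lw_def by (intro continuous_intros f h)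
  then have "isCont Lw q"
    by (simp add: continuous_on_eq_continuous_at)
  ultimately have "\<forall>\<^sub>F x in at q. 0 < Lw x"
    by (simp add: isCont_def order_tendstoD(1))
  then obtain R where "0 < R" and R: "\<And>x. x \<noteq> q \<Longrightarrow> dist x q < R \<Longrightarrow> 0 < Lw x"
    unfolding eventually_at by auto
  define r where "r = R / 2"
  have r: "0 < r" "r < R"
    using \<open>0 < R\<close> by (auto simp: r_def)
  have Lw: "0 < Lw x" if "dist q x \<le> r" for x
    using R[of x] that r \<open>0 < Lw q\<close> by (cases "x = q") (auto simp: dist_commute)
  have contV: "continuous_on A V" for A
    using V differentiable_imp_continuous_within continuous_at_imp_continuous_on by blast
  have "sphere q r \<noteq> {}"
    using \<open>0 < r\<close> by simp
  then obtain b where b: "b \<in> sphere q r" and b_min: "\<And>x. x \<in> sphere q r \<Longrightarrow> V b \<le> V x"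
    using continuous_attains_inf[OF compact_sphere _ contV] by blast
  have "0 < V b"
    using b pos r by (auto simp: positive_definite_about_def)
  \<comment> \<open>the barrier is at most \<open>r\<^sup>2\<close> on the sphere, so that \<open>V - \<epsilon> w \<ge> V b / 2\<close> there\<close>
  define \<epsilon> where "\<epsilon> = V b / (2 * r\<^sup>2)"
  have "0 < \<epsilon>"
    using \<open>0 < V b\<close> r by (simp add: \<epsilon>_def)
  define W where "W x = V x - \<epsilon> * (x$i - q$i)\<^sup>2" for x
  have "continuous_on (cball q r) W"
    unfolding W_def by (intro continuous_intros contV)
  moreover have "cball q r \<noteq> {}"
    using r by simp
  ultimately obtain p where p: "p \<in> cball q r" and p_min: "\<And>x. x \<in> cball q r \<Longrightarrow> W p \<le> W x"
    using continuous_attains_inf[OF compact_cball] by blast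
  have "W p \<le> 0"
    using p_min[of q] r pos by (simp add: W_def positive_definite_about_def)
  have "dist q p \<noteq> r"
  proof
    assume on_sphere: "dist q p = r"
    have "\<bar>p$i - q$i\<bar> \<le> r"
      using component_le_norm_cart[of "p - q" i] on_sphere by (simp add: dist_norm norm_minus_commute)
    then have "(p$i - q$i)\<^sup>2 \<le> r\<^sup>2"
      using r by (intro abs_le_square_iff[THEN iffD1]) simp
    then have "\<epsilon> * (p$i - q$i)\<^sup>2 \<le> \<epsilon> * r\<^sup>2"
      using \<open>0 < \<epsilon>\<close> by simp
    also have "\<dots> = V b / 2"
      using r by (simp add: \<epsilon>_def)
    finally show False
      using b_min[of p] on_sphere \<open>0 < V b\<close> \<open>W p \<le> 0\<close> by (simp add: W_def)
  qed
  then have d: "0 < r - dist q p"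
    using p by simp
  have "W p \<le> W x" if "dist p x < r - dist q p" for x
    using p_min[of x] that dist_triangle[of q x p] by simp
  then have "\<epsilon> * Lw p \<le> generator f h V p u"
    unfolding W_def Lw_def by (intro generator_ge_at_touching_point[OF V G d])
  moreover have "0 < \<epsilon> * Lw p"
    using Lw[of p] p \<open>0 < \<epsilon>\<close> by simp
  ultimately show False
    using super[of p] by simp
qed

theorem theorem3:
  fixes U :: "(real^'m) set"
    and f :: "real^'n \<Rightarrow> real^'m \<Rightarrow> real^'n"
    and h :: "real^'n \<Rightarrow> real^'m \<Rightarrow> real^'r^'n"
    and s :: "real^'n \<Rightarrow> real^'m \<Rightarrow> real^'m"
    and V :: "real^'n \<Rightarrow> real"
    and xbar :: "real^'n"
  assumes "io_stochastic_system U f h s"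
    and "radially_unbounded_lyapunov V"
    and "stochastically_passive U f h s V"
    and "stochastic_passive_state V xbar"
  shows "h xbar 0 = 0"
proof (rule diffusion_vanishes_at_strict_minimum)
  have C2: "C2 V" and def: "\<exists>q. positive_definite_about q V"
    using assms(2) by (auto simp: radially_unbounded_lyapunov_def)
  show "V differentiable (at x)" "gradient V differentiable (at x)" for x
    using C2 by (auto simp: C2_def differentiable_on_def)
  show "positive_definite_about xbar V"
    using def assms(4)
    by (metis less_irrefl positive_definite_about_def stochastic_passive_state_def)
  have "0 \<in> U"
    using assms(1) by (simp add: io_stochastic_system_def)
  then show "continuous_on UNIV (\<lambda>x. f x 0)" "continuous_on UNIV (\<lambda>x. h x 0)"
    using assms(1) locally_lipschitz_on_imp_continuous_on_slice
    unfolding io_stochastic_system_def by blast+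
  show "generator f h V x 0 \<le> 0" for x
    using assms(3) \<open>0 \<in> U\<close> unfolding stochastically_passive_def by force
qed

end
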